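(* For any $\eta>0$, there is a holomorphic embedding $f:\mathbb{H}^1_{\mathbb{C}}\rightarrow\mathbb{H}^2_{\mathbb{C}}$ whose second fundamental form satisfies $\sup\|\mathrm{II}_f\|^2<\eta$, and such that $f$ is not totally geodesic.
   Context: $\mathbb{H}^k_{\mathbb{C}}$ is complex hyperbolic space of complex dimension $k$; $\mathbb{H}^2_{\mathbb{C}}$ carries its symmetric metric normalized with sectional curvature in $[-4,-1]$. The second fundamental form $\mathrm{II}_f$ is that of the immersed surface $f$ with its induced metric, with pointwise norm $\|\mathrm{II}_f\|^2=\frac12\sum_{i,j}|\mathrm{II}_f(e_i,e_j)|^2$ for $(e_1,e_2)$ an orthonormal frame of the induced metric. *)

theory Defs
  imports "HOL-Analysis.Analysis"
begin

text \<open>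
  A Riemannian metric on an open subset of a Euclidean space is given by a function \<open>g\<close>, where
  \<open>g p u v\<close> is the inner product at \<open>p\<close> of the tangent vectors \<open>u\<close> and \<open>v\<close>.  All tangent spaces
  are identified with the ambient vector space.
\<close>

type_synonym 'a riem = "'a \<Rightarrow> 'a \<Rightarrow> 'a \<Rightarrow> real"

text \<open>
  The Christoffel symbols of the Levi-Civita connection, as the bilinear map that takes \<open>u\<close> and \<open>v\<close>
  to the covariant derivative at \<open>p\<close> of the constant field \<open>v\<close> in the direction \<open>u\<close>.
  The defining equation is the Koszul formula for constant (hence commuting) vector fields.
\<close>

definition christoffel :: "'a::euclidean_space riem \<Rightarrow> 'a \<Rightarrow> 'a \<Rightarrow> 'a \<Rightarrow> 'a" where
  "christoffel g p u v =
     (THE x. \<forall>w. 2 * g p x w =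
        frechet_derivative (\<lambda>q. g q v w) (at p) u
      + frechet_derivative (\<lambda>q. g q u w) (at p) v
      - frechet_derivative (\<lambda>q. g q u v) (at p) w)"

text \<open>
  The covariant derivative at \<open>p\<close>, in the direction \<open>X\<close>, of a vector field \<open>V\<close> along \<open>f\<close>
  (so \<open>V q\<close> is tangent to the target at \<open>f q\<close>), for the Levi-Civita connection of the target.
\<close>

definition cov_deriv_along ::
  "'a::euclidean_space riem \<Rightarrow> ('b::euclidean_space \<Rightarrow> 'a) \<Rightarrow> ('b \<Rightarrow> 'a) \<Rightarrow> 'b \<Rightarrow> 'b \<Rightarrow> 'a" where
  "cov_deriv_along g f V p X =
     frechet_derivative V (at p) X
     + christoffel g (f p) (frechet_derivative f (at p) X) (V p)"

definition normal_part :: "'a::euclidean_space riem \<Rightarrow> 'a \<Rightarrow> 'a set \<Rightarrow> 'a \<Rightarrow> 'a" where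
  "normal_part g p T x = (THE n. x - n \<in> T \<and> (\<forall>t\<in>T. g p n t = 0))"

text \<open>
  The second fundamental form of an immersion \<open>f\<close>: the normal component of the covariant
  derivative of \<open>df(Y)\<close> in the direction \<open>X\<close>.  It is tensorial in both arguments, so \<open>Y\<close> may be
  extended as a constant field on the domain.
\<close>

definition second_ff ::
  "'a::euclidean_space riem \<Rightarrow> ('b::euclidean_space \<Rightarrow> 'a) \<Rightarrow> 'b \<Rightarrow> 'b \<Rightarrow> 'b \<Rightarrow> 'a" where
  "second_ff g f p X Y =
     normal_part g (f p) (range (frechet_derivative f (at p)))
       (cov_deriv_along g f (\<lambda>q. frechet_derivative f (at q) Y) p X)"

definition induced_metric ::
  "'a::euclidean_space riem \<Rightarrow> ('b::euclidean_space \<Rightarrow> 'a) \<Rightarrow> 'b riem" where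
  "induced_metric g f p X Y =
     g (f p) (frechet_derivative f (at p) X) (frechet_derivative f (at p) Y)"

definition orthonormal_frame2 :: "'b::euclidean_space riem \<Rightarrow> 'b \<Rightarrow> (nat \<Rightarrow> 'b) \<Rightarrow> bool" where
  "orthonormal_frame2 h p e \<longleftrightarrow>
     (\<forall>i\<in>{1,2}. \<forall>j\<in>{1,2}. h p (e i) (e j) = (if i = j then 1 else 0))"

text \<open>
  The squared norm of the second fundamental form of an immersed surface (the domain has real
  dimension 2), including the factor 1/2.  The value does not depend on the chosen frame.
\<close>

definition norm_second_ff_sq ::
  "'a::euclidean_space riem \<Rightarrow> ('b::euclidean_space \<Rightarrow> 'a) \<Rightarrow> 'b \<Rightarrow> real" where
  "norm_second_ff_sq g f p =
     (let e = (SOME e. orthonormal_frame2 (induced_metric g f) p e) in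
        1 / 2 * (\<Sum>i\<in>{1,2}. \<Sum>j\<in>{1,2}.
          g (f p) (second_ff g f p (e i) (e j)) (second_ff g f p (e i) (e j))))"

definition totally_geodesic_on ::
  "'a::euclidean_space riem \<Rightarrow> 'b::euclidean_space set \<Rightarrow> ('b \<Rightarrow> 'a) \<Rightarrow> bool" where
  "totally_geodesic_on g S f \<longleftrightarrow> (\<forall>p\<in>S. \<forall>X Y. second_ff g f p X Y = 0)"

text \<open>
  Complex hyperbolic space of complex dimension \<open>CARD('n)\<close> in the ball model: the unit ball with
  the Bergman metric, scaled so that complex lines have curvature \<open>-4\<close> (in one dimension the
  metric is \<open>|dz|^2 / (1 - |z|^2)^2\<close>) and totally real planes have curvature \<open>-1\<close> (the real points
  form the Klein model of curvature \<open>-1\<close>).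
\<close>

definition hermitian :: "complex ^ 'n \<Rightarrow> complex ^ 'n \<Rightarrow> complex" where
  "hermitian u v = (\<Sum>i\<in>UNIV. u $ i * cnj (v $ i))"

definition complex_hyperbolic :: "(complex ^ 'n) set" where
  "complex_hyperbolic = ball 0 1"

definition bergman_metric :: "(complex ^ 'n) riem" where
  "bergman_metric z u v =
     Re (hermitian u v / complex_of_real (1 - (norm z)\<^sup>2)
       + hermitian u z * hermitian z v / complex_of_real ((1 - (norm z)\<^sup>2)\<^sup>2))"

text \<open>
  The complex hyperbolic line is the unit disc of the complex plane; only its complex structure is
  used, since an immersed surface carries its induced metric.
\<close>

definition complex_hyperbolic_line :: "complex set" where
  "complex_hyperbolic_line = ball 0 1"

definition holomorphic_embedding ::
  "complex set \<Rightarrow> (complex ^ 'n) set \<Rightarrow> (complex \<Rightarrow> complex ^ 'n) \<Rightarrow> bool" where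
  "holomorphic_embedding S M f \<longleftrightarrow>
     f ` S \<subseteq> M
   \<and> (\<forall>i. (\<lambda>z. f z $ i) holomorphic_on S)
   \<and> (\<forall>z\<in>S. inj (frechet_derivative f (at z)))
   \<and> (\<exists>h. homeomorphism S (f ` S) f h)"

end

theory Submission
  imports Defs
begin

text \<open>
  The curve \<open>z \<mapsto> (z / 2, c z\<^sup>2)\<close> with a small real \<open>c > 0\<close> has the required properties.  It maps
  the unit disc into a fixed compact part of the ball, so it suffices to bound its second
  fundamental form there by a multiple of \<open>c\<close>, and to see that the form is nonzero at one point.

  What makes the computation short is that the Bergman metric is Kaehler and has the complex
  lines of the ball as totally geodesic submanifolds.  Write \<open>\<langle>u, v\<rangle>\<close> for the standard Hermitian
  product.  The Christoffel symbols are
  \<open>\<Gamma>\<^sub>p(u, v) = (\<langle>u, p\<rangle> v + \<langle>v, p\<rangle> u) / (1 - |p|\<^sup>2)\<close> (lemma \<open>christoffel_bergman\<close>): complex bilinear,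
  and on the diagonal proportional to \<open>u\<close>.  Hence, along any holomorphic curve \<open>f\<close> in the ball, the
  Christoffel term of the covariant derivative is tangent to the curve, and the second
  fundamental form is \<open>(X, Y) \<mapsto> X Y N\<close>, where \<open>N\<close> is the component of the Euclidean second
  derivative \<open>f''\<close> that is normal to \<open>f'\<close> for the Bergman metric (lemma
  \<open>second_ff_holomorphic_curve\<close>).

  A vector \<open>X\<close> is of unit length for the induced metric when \<open>|X|\<^sup>2 = 1 / \<parallel>f'\<parallel>\<^sup>2\<close>, so the squared norm
  of the second fundamental form is \<open>2 \<parallel>N\<parallel>\<^sup>2 / \<parallel>f'\<parallel>\<^sup>4\<close>.  Comparing the Bergman metric with the
  Euclidean one bounds this by \<open>2 |f''|\<^sup>2 / ((1 - |f|\<^sup>2)\<^sup>2 |f'|\<^sup>4)\<close> (lemma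
  \<open>norm_second_ff_sq_holomorphic_curve_le\<close>).  For the curve above, \<open>|f''| = 2 c\<close> and \<open>|f'| \<ge> 1 / 2\<close>,
  and \<open>|f|\<^sup>2 \<le> 1 / 2\<close> once \<open>c \<le> 1 / 2\<close>; the bound becomes \<open>512 c\<^sup>2\<close>.  At the origin \<open>f'\<close> and \<open>f''\<close> are
  orthogonal, so that \<open>N = f'' \<noteq> 0\<close> and the curve is not totally geodesic.
\<close>

section \<open>The Hermitian form and the Bergman metric\<close>

lemma hermitian_add_left: "hermitian (u + v) w = hermitian u w + hermitian v w"
  by (simp add: hermitian_def sum.distrib algebra_simps)

lemma hermitian_add_right: "hermitian u (v + w) = hermitian u v + hermitian u w"
  by (simp add: hermitian_def sum.distrib algebra_simps)

lemma hermitian_scale_left: "hermitian (c *s u) w = c * hermitian u w"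
  by (simp add: hermitian_def sum_distrib_left algebra_simps)

lemma hermitian_scale_right: "hermitian u (c *s w) = cnj c * hermitian u w"
  by (simp add: hermitian_def sum_distrib_left algebra_simps)

lemma cnj_hermitian: "cnj (hermitian u v) = hermitian v u"
  by (simp add: hermitian_def algebra_simps)

lemma hermitian_self: "hermitian u u = complex_of_real ((norm u)\<^sup>2)"
  unfolding hermitian_def complex_norm_square[symmetric] norm_vec_def L2_set_def
  by (simp add: real_sqrt_pow2 sum_nonneg)

lemma scaleR_eq_scale: "a *\<^sub>R (u :: complex ^ 'n) = complex_of_real a *s u"
  by (simp add: vec_eq_iff scaleR_conv_of_real[where 'a = complex])

lemma Re_hermitian: "Re (hermitian u v) = u \<bullet> v"
  by (simp add: hermitian_def inner_vec_def inner_complex_def)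

lemma bounded_bilinear_hermitian: "bounded_bilinear hermitian"
  unfolding bilinear_conv_bounded_bilinear[symmetric] bilinear_def
  by (auto intro!: linearI
      simp: hermitian_add_left hermitian_add_right scaleR_eq_scale hermitian_scale_left
        hermitian_scale_right scaleR_conv_of_real)

lemma norm_hermitian_le: "norm (hermitian u v) \<le> norm u * norm v"
proof -
  have "norm (hermitian u v) \<le> (\<Sum>i\<in>UNIV. norm (u $ i) * norm (v $ i))"
    unfolding hermitian_def by (rule order_trans[OF norm_sum]) (simp add: norm_mult)
  also have "\<dots> \<le> norm u * norm v"
    unfolding norm_vec_def
    using L2_set_mult_ineq[of "\<lambda>i. norm (u $ i)" "\<lambda>i. norm (v $ i)" UNIV] by simp
  finally show ?thesis .
qed

text \<open>
  The complex-valued Hermitian form whose real part is the Bergman metric.  Complex scalars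
  factor out of it, but not out of its real part.
\<close>

definition bergman_form :: "complex ^ 'n \<Rightarrow> complex ^ 'n \<Rightarrow> complex ^ 'n \<Rightarrow> complex" where
  "bergman_form z u v =
     hermitian u v / complex_of_real (1 - (norm z)\<^sup>2)
     + hermitian u z * hermitian z v / complex_of_real ((1 - (norm z)\<^sup>2)\<^sup>2)"

lemma bergman_metric_eq_Re: "bergman_metric z u v = Re (bergman_form z u v)"
  by (simp add: bergman_metric_def bergman_form_def)

lemma bergman_form_add_left: "bergman_form z (u + v) w = bergman_form z u w + bergman_form z v w"
  by (simp add: bergman_form_def hermitian_add_left add_divide_distrib algebra_simps)

lemma bergman_form_scale_left: "bergman_form z (c *s u) w = c * bergman_form z u w"
  by (simp add: bergman_form_def hermitian_scale_left algebra_simps)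

lemma bergman_form_scale_right: "bergman_form z u (c *s w) = cnj c * bergman_form z u w"
  by (simp add: bergman_form_def hermitian_scale_right algebra_simps)

lemma bergman_form_diff_left: "bergman_form z (u - v) w = bergman_form z u w - bergman_form z v w"
  using bergman_form_add_left[of z "u - v" v w] by simp

lemma cnj_bergman_form: "cnj (bergman_form z u v) = bergman_form z v u"
  by (simp add: bergman_form_def cnj_hermitian mult.commute)

lemma bergman_form_self:
  "bergman_form z u u = complex_of_real
     ((norm u)\<^sup>2 / (1 - (norm z)\<^sup>2) + (norm (hermitian u z))\<^sup>2 / (1 - (norm z)\<^sup>2)\<^sup>2)"
proof -
  have "hermitian u z * hermitian z u = complex_of_real ((norm (hermitian u z))\<^sup>2)"
    by (metis cnj_hermitian complex_norm_square of_real_power)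
  then show ?thesis
    by (simp add: bergman_form_def hermitian_self)
qed

lemma bergman_form_self_eq_metric: "bergman_form z u u = complex_of_real (bergman_metric z u u)"
  by (simp add: bergman_form_self bergman_metric_eq_Re)

lemma bergman_metric_scale_self:
  "bergman_metric z (c *s u) (c *s u) = (norm c)\<^sup>2 * bergman_metric z u u"
proof -
  have "bergman_form z (c *s u) (c *s u) = (c * cnj c) * bergman_form z u u"
    by (simp add: bergman_form_scale_left bergman_form_scale_right)
  also have "\<dots> = complex_of_real ((norm c)\<^sup>2 * bergman_metric z u u)"
    by (simp only: bergman_form_self_eq_metric complex_norm_square of_real_mult)
  finally show ?thesis by (simp add: bergman_metric_eq_Re)
qed

lemma one_minus_norm_sq_pos: "norm z < 1 \<Longrightarrow> 0 < 1 - (norm (z :: 'a :: real_normed_vector))\<^sup>2"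
  by (simp add: power_less_one_iff abs_square_less_1)

text \<open>
  The Bergman metric is at least the Euclidean one, and at most \<open>1 / (1 - |z|\<^sup>2)\<^sup>2\<close> times it
  by the Cauchy-Schwarz inequality.  The lower bound also yields definiteness, on which the
  uniqueness of covariant derivatives and of normal components rests.
\<close>

lemma bergman_metric_ge:
  assumes "norm z < 1"
  shows "(norm u)\<^sup>2 \<le> bergman_metric z u u"
proof -
  have r: "0 < 1 - (norm z)\<^sup>2" "1 - (norm z)\<^sup>2 \<le> 1"
    using one_minus_norm_sq_pos[OF assms] by auto
  have "(norm u)\<^sup>2 \<le> (norm u)\<^sup>2 / (1 - (norm z)\<^sup>2)"
    using r by (simp add: pos_le_divide_eq mult_left_le)
  also have "\<dots> \<le> bergman_metric z u u"
    by (simp add: bergman_metric_eq_Re bergman_form_self)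
  finally show ?thesis .
qed

lemma bergman_metric_le:
  assumes "norm z < 1"
  shows "bergman_metric z u u \<le> (norm u)\<^sup>2 / (1 - (norm z)\<^sup>2)\<^sup>2"
proof -
  have r: "0 < 1 - (norm z)\<^sup>2"
    using one_minus_norm_sq_pos[OF assms] by auto
  have "bergman_metric z u u
      = ((norm u)\<^sup>2 * (1 - (norm z)\<^sup>2) + (norm (hermitian u z))\<^sup>2) / (1 - (norm z)\<^sup>2)\<^sup>2"
    using r by (simp add: bergman_metric_eq_Re bergman_form_self add_divide_distrib power2_eq_square)
  also have "\<dots> \<le> (norm u)\<^sup>2 / (1 - (norm z)\<^sup>2)\<^sup>2"
  proof (rule divide_right_mono)
    have "(norm (hermitian u z))\<^sup>2 \<le> (norm u * norm z)\<^sup>2"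
      by (intro power_mono norm_hermitian_le) simp
    then show "(norm u)\<^sup>2 * (1 - (norm z)\<^sup>2) + (norm (hermitian u z))\<^sup>2 \<le> (norm u)\<^sup>2"
      by (simp add: power_mult_distrib algebra_simps)
  qed simp
  finally show ?thesis .
qed

lemma bergman_metric_pos:
  assumes "norm z < 1" "u \<noteq> 0"
  shows "0 < bergman_metric z u u"
  using bergman_metric_ge[OF assms(1), of u] assms(2)
  by (meson less_le_trans zero_less_norm_iff zero_less_power)

section \<open>The Levi-Civita connection of the Bergman metric\<close>

lemma has_derivative_bergman_metric:
  assumes "norm p < 1"
  shows "((\<lambda>q. bergman_metric q v w) has_derivative
    (\<lambda>u. Re (hermitian v w) * (2 * Re (hermitian u p)) / (1 - (norm p)\<^sup>2)\<^sup>2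
       + Re (hermitian v u * hermitian p w + hermitian v p * hermitian u w) / (1 - (norm p)\<^sup>2)\<^sup>2
       + Re (hermitian v p * hermitian p w) * (4 * Re (hermitian u p)) / (1 - (norm p)\<^sup>2) ^ 3))
    (at p)"
proof -
  have r: "0 < 1 - p \<bullet> p"
    using one_minus_norm_sq_pos[OF assms] by (simp add: power2_norm_eq_inner)
  then have r0: "1 - p \<bullet> p \<noteq> 0" by simp
  have eq: "bergman_metric q v w = Re (hermitian v w) * inverse (1 - q \<bullet> q)
      + Re (hermitian v q * hermitian q w) * (inverse (1 - q \<bullet> q))\<^sup>2" for q :: "complex ^ 'a"
    by (simp only: bergman_metric_eq_Re bergman_form_def power2_norm_eq_inner plus_complex.simps
        Re_divide_of_real) (simp add: field_simps)
  have dr: "((\<lambda>q. 1 - q \<bullet> q) has_derivative (\<lambda>u. - 2 * (u \<bullet> p))) (at p)"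
    by (auto intro!: derivative_eq_intros simp: inner_commute)
  have "((\<lambda>q. hermitian v q) has_derivative hermitian v) (at p)"
    "((\<lambda>q. hermitian q w) has_derivative (\<lambda>u. hermitian u w)) (at p)"
    by (intro bounded_linear_imp_has_derivative bounded_bilinear.bounded_linear_left
        bounded_bilinear.bounded_linear_right bounded_bilinear_hermitian)+
  from has_derivative_mult[OF this]
  have "((\<lambda>q. hermitian v q * hermitian q w) has_derivative
      (\<lambda>u. hermitian v u * hermitian p w + hermitian v p * hermitian u w)) (at p)"
    by (simp add: add.commute)
  then have dB: "((\<lambda>q. Re (hermitian v q * hermitian q w)) has_derivative
      (\<lambda>u. Re (hermitian v u * hermitian p w + hermitian v p * hermitian u w))) (at p)"
    by (rule bounded_linear.has_derivative[OF bounded_linear_Re])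
  \<comment> \<open>The product and chain rules give the left-hand side, with \<open>s = 1 / (1 - |p|\<^sup>2)\<close>.\<close>
  have collect: "A * - (s * (- 2 * x) * s) + (B * (real 2 * - (s * (- 2 * x) * s) * s ^ (2 - 1)) + C * s\<^sup>2)
      = A * (2 * x) * s\<^sup>2 + C * s\<^sup>2 + B * (4 * x) * s ^ 3" for A B C s x :: real
    by (simp add: power2_eq_square power3_eq_cube algebra_simps)
  show ?thesis
    unfolding eq power2_norm_eq_inner Re_hermitian[of _ p]
    by (rule dB dr derivative_eq_intros refl r0 ext)+
      (simp only: divide_inverse power_inverse[symmetric] collect)
qed

text \<open>
  Each derivative in the Koszul formula differentiates the metric both through its Hermitian
  numerators and through the powers of \<open>1 - |p|\<^sup>2\<close>.  Up to conjugation, which the real part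
  ignores, the terms antilinear in \<open>u\<close> or \<open>v\<close> cancel in the alternating sum; the remaining ones are
  the Hermitian product of twice the vector below with \<open>w\<close>.  Definiteness of the metric makes this
  vector unique.
\<close>

lemma christoffel_bergman:
  assumes "norm p < 1"
  shows "christoffel bergman_metric p u v =
    complex_of_real (1 / (1 - (norm p)\<^sup>2)) *s (hermitian u p *s v + hermitian v p *s u)"
  (is "_ = ?G")
proof -
  define r where "r = 1 - (norm p)\<^sup>2"
  have r: "0 < r"
    unfolding r_def using one_minus_norm_sq_pos[OF assms] .
  have D: "frechet_derivative (\<lambda>q. bergman_metric q v w) (at p) u =
      Re (hermitian v w) * (2 * Re (hermitian u p)) / r\<^sup>2
       + Re (hermitian v u * hermitian p w + hermitian v p * hermitian u w) / r\<^sup>2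
       + Re (hermitian v p * hermitian p w) * (4 * Re (hermitian u p)) / r ^ 3" for u v w
    unfolding r_def
    by (rule fun_cong[OF frechet_derivative_at[OF has_derivative_bergman_metric[OF assms], symmetric]])
  have koszul: "2 * bergman_metric p ?G w =
        frechet_derivative (\<lambda>q. bergman_metric q v w) (at p) u
      + frechet_derivative (\<lambda>q. bergman_metric q u w) (at p) v
      - frechet_derivative (\<lambda>q. bergman_metric q u v) (at p) w" for w
  proof -
    \<comment> \<open>Naming the six Hermitian products turns the Koszul identity into a polynomial identity in
      their real and imaginary parts, with coefficients in the powers of \<open>1 / r\<close>.\<close>
    define a b c d e f where "a = hermitian u p" and "b = hermitian v p" and "c = hermitian w p"
      and "d = hermitian u v" and "e = hermitian u w" and "f = hermitian v w"
    have conj: "hermitian p u = cnj a" "hermitian p v = cnj b" "hermitian p w = cnj c"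
      "hermitian v u = cnj d" "hermitian w u = cnj e" "hermitian w v = cnj f"
      by (simp_all add: a_def b_def c_def d_def e_def f_def cnj_hermitian)
    have form: "bergman_form p ?G w =
        (a * f + b * e) / of_real (r\<^sup>2) + 2 * (a * b * cnj c) / of_real (r ^ 3)"
      using r unfolding bergman_form_def r_def[symmetric] conj
      by (simp add: hermitian_scale_left hermitian_add_left a_def[symmetric] b_def[symmetric]
          e_def[symmetric] f_def[symmetric] conj field_simps power2_eq_square power3_eq_cube)
    have Re_form: "bergman_metric p ?G w =
        Re (a * f + b * e) / r\<^sup>2 + 2 * Re (a * b * cnj c) / r ^ 3"
      unfolding bergman_metric_eq_Re form plus_complex.simps Re_divide_of_real by simp
    show ?thesis
      unfolding Re_form D
      unfolding conj a_def[symmetric] b_def[symmetric] c_def[symmetric]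
        d_def[symmetric] e_def[symmetric] f_def[symmetric]
      using r by (simp add: add_divide_distrib diff_divide_distrib algebra_simps)
  qed
  show ?thesis
    unfolding christoffel_def
  proof (rule the_equality)
    show "\<forall>w. 2 * bergman_metric p ?G w =
        frechet_derivative (\<lambda>q. bergman_metric q v w) (at p) u
      + frechet_derivative (\<lambda>q. bergman_metric q u w) (at p) v
      - frechet_derivative (\<lambda>q. bergman_metric q u v) (at p) w"
      using koszul by blast
  next
    fix x
    assume "\<forall>w. 2 * bergman_metric p x w =
        frechet_derivative (\<lambda>q. bergman_metric q v w) (at p) u
      + frechet_derivative (\<lambda>q. bergman_metric q u w) (at p) v
      - frechet_derivative (\<lambda>q. bergman_metric q u v) (at p) w"
    then have "bergman_metric p x w = bergman_metric p ?G w" for w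
      using koszul[of w] by (metis mult_cancel_left zero_neq_numeral)
    then have "bergman_metric p (x - ?G) (x - ?G) = 0"
      by (simp add: bergman_metric_eq_Re bergman_form_diff_left)
    then show "x = ?G"
      using bergman_metric_pos[OF assms, of "x - ?G"] by fastforce
  qed
qed

section \<open>Holomorphic curves in complex hyperbolic space\<close>

definition bergman_normal :: "complex ^ 'n \<Rightarrow> complex ^ 'n \<Rightarrow> complex ^ 'n \<Rightarrow> complex ^ 'n" where
  "bergman_normal p t x = x - (bergman_form p x t / bergman_form p t t) *s t"

lemma bergman_form_normal:
  assumes "norm p < 1" "t \<noteq> 0"
  shows "bergman_form p (bergman_normal p t x) t = 0"
proof -
  have "bergman_form p t t \<noteq> 0"
    using bergman_metric_pos[OF assms] by (simp add: bergman_form_self_eq_metric)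
  then show ?thesis
    by (simp add: bergman_normal_def bergman_form_diff_left bergman_form_scale_left)
qed

text \<open>
  The tangent space of a holomorphic curve is a complex line \<open>\<complex> t\<close>, so real orthogonality to it is
  the same as orthogonality for the Hermitian form, and the normal component is the Hermitian
  projection.  A multiple of \<open>t\<close> can be split off beforehand; for a covariant derivative this
  is the Christoffel term.
\<close>

lemma normal_part_bergman:
  assumes p: "norm p < 1" and t: "t \<noteq> 0" and x: "x = y + c *s t"
  shows "normal_part bergman_metric p (range (\<lambda>X. X *s t)) x = bergman_normal p t y"
  unfolding normal_part_def
proof (rule the_equality)
  let ?n = "bergman_normal p t y"
  have "x - ?n = (c + bergman_form p y t / bergman_form p t t) *s t"
    by (simp add: bergman_normal_def x vector_sadd_rdistrib algebra_simps)
  then have "x - ?n \<in> range (\<lambda>X. X *s t)" by blast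
  moreover have "bergman_metric p ?n (X *s t) = 0" for X
    by (simp add: bergman_metric_eq_Re bergman_form_scale_right bergman_form_normal[OF p t])
  ultimately show n: "x - ?n \<in> range (\<lambda>X. X *s t) \<and>
      (\<forall>s\<in>range (\<lambda>X. X *s t). bergman_metric p ?n s = 0)"
    by blast
  fix m
  assume m: "x - m \<in> range (\<lambda>X. X *s t) \<and>
      (\<forall>s\<in>range (\<lambda>X. X *s t). bergman_metric p m s = 0)"
  obtain a b where "x - ?n = a *s t" "x - m = b *s t"
    using n m by blast
  then have "m - ?n = (a - b) *s t"
    by (simp add: vec_eq_iff algebra_simps)
  then have "m - ?n \<in> range (\<lambda>X. X *s t)" by blast
  then have "bergman_metric p (m - ?n) (m - ?n) = 0"
    using n m unfolding bergman_metric_eq_Re bergman_form_diff_left minus_complex.simps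
    by (metis diff_self)
  then show "m = ?n"
    using bergman_metric_pos[OF p, of "m - ?n"] by fastforce
qed

lemma bergman_metric_normal_le:
  assumes p: "norm p < 1" and t: "t \<noteq> 0"
  shows "bergman_metric p (bergman_normal p t x) (bergman_normal p t x) \<le> bergman_metric p x x"
proof -
  \<comment> \<open>Pythagoras for the decomposition of \<open>x\<close> into its normal part and a multiple of \<open>t\<close>.\<close>
  let ?n = "bergman_normal p t x" and ?c = "bergman_form p x t / bergman_form p t t"
  have x: "x = ?n + ?c *s t" by (simp add: bergman_normal_def)
  have nt: "bergman_form p ?n t = 0" by (rule bergman_form_normal[OF p t])
  then have tn: "bergman_form p t ?n = 0" using cnj_bergman_form[of p ?n t] by simp
  have "bergman_form p x ?n = bergman_form p ?n ?n"
    by (subst x) (simp add: bergman_form_add_left bergman_form_scale_left tn)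
  then have nx: "bergman_form p ?n x = bergman_form p ?n ?n"
    using cnj_bergman_form[of p x ?n] cnj_bergman_form[of p ?n ?n] by simp
  have "bergman_form p (?c *s t) x = bergman_form p (?c *s t) (?c *s t)"
  proof -
    have "bergman_form p x (?c *s t) = bergman_form p (?c *s t) (?c *s t)"
      by (subst x) (simp add: bergman_form_add_left bergman_form_scale_right nt)
    then show ?thesis
      using cnj_bergman_form[of p x "?c *s t"] cnj_bergman_form[of p "?c *s t" "?c *s t"] by simp
  qed
  then have "bergman_form p x x = bergman_form p ?n ?n + bergman_form p (?c *s t) (?c *s t)"
    using nx bergman_form_add_left[of p ?n "?c *s t" x] x by simp
  moreover have "0 \<le> bergman_metric p (?c *s t) (?c *s t)"
    using bergman_metric_ge[OF p, of "?c *s t"] by (meson order_trans zero_le_power2)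
  ultimately show ?thesis by (simp add: bergman_metric_eq_Re)
qed

lemma has_derivative_holomorphic_curve:
  fixes f :: "complex \<Rightarrow> complex ^ 'n"
  assumes "\<And>i. ((\<lambda>z. f z $ i) has_field_derivative f' $ i) (at z)"
  shows "(f has_derivative (\<lambda>X. X *s f')) (at z)"
proof -
  have "((\<lambda>z. f z $ i) has_derivative (\<lambda>X. (X *s f') $ i)) (at z)" for i
    using assms[of i] by (simp add: has_field_derivative_def mult_commute_abs)
  then have "((\<lambda>z. f z \<bullet> axis i b) has_derivative (\<lambda>X. (X *s f') \<bullet> axis i b)) (at z)" for i b
    by (simp only: inner_axis) (rule has_derivative_inner_left)
  then show ?thesis
    unfolding has_derivative_componentwise_within[of f]
    by (auto simp: Basis_vec_def)
qed

text \<open>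
  With \<open>u = X f'\<close> and \<open>v = Y f'\<close>, the Christoffel term is a complex multiple of \<open>f'\<close> and disappears in
  the normal component.  Only the second derivative in the coordinates of the ball contributes.
\<close>

lemma second_ff_holomorphic_curve:
  fixes f :: "complex \<Rightarrow> complex ^ 'n"
  assumes S: "open S" "p \<in> S"
    and f': "\<And>z i. z \<in> S \<Longrightarrow> ((\<lambda>z. f z $ i) has_field_derivative f' z $ i) (at z)"
    and f'': "\<And>i. ((\<lambda>z. f' z $ i) has_field_derivative f'' $ i) (at p)"
    and p: "norm (f p) < 1" "f' p \<noteq> 0"
  shows "second_ff bergman_metric f p X Y = (X * Y) *s bergman_normal (f p) (f' p) f''"
proof -
  have df: "frechet_derivative f (at z) = (\<lambda>X. X *s f' z)" if "z \<in> S" for z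
    using frechet_derivative_at[OF has_derivative_holomorphic_curve[OF f'[OF that]]] by simp
  have "((\<lambda>z. Y *s f' z) has_derivative (\<lambda>X. X *s (Y *s f''))) (at p)"
    by (rule has_derivative_holomorphic_curve) (simp add: DERIV_cmult[OF f''])
  then have "((\<lambda>z. frechet_derivative f (at z) Y) has_derivative (\<lambda>X. X *s (Y *s f''))) (at p)"
    by (rule has_derivative_transform_within_open[OF _ S]) (simp add: df)
  then have ddf: "frechet_derivative (\<lambda>z. frechet_derivative f (at z) Y) (at p) X = (X * Y) *s f''"
    by (metis frechet_derivative_at vector_smult_assoc)
  have cov: "cov_deriv_along bergman_metric f (\<lambda>q. frechet_derivative f (at q) Y) p X =
      (X * Y) *s f'' + (2 * X * Y * hermitian (f' p) (f p) / of_real (1 - (norm (f p))\<^sup>2)) *s f' p"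
    unfolding cov_deriv_along_def ddf christoffel_bergman[OF p(1)] df[OF S(2)]
    by (simp add: vec_eq_iff hermitian_scale_left algebra_simps)
  show ?thesis
    unfolding second_ff_def df[OF S(2)] normal_part_bergman[OF p cov]
    by (simp add: bergman_normal_def bergman_form_scale_left vector_sub_rdistrib algebra_simps)
qed

text \<open>
  The induced metric is the conformal metric \<open>\<parallel>f'\<parallel>\<^sup>2 |dz|\<^sup>2\<close>, so both vectors of any orthonormal frame
  have Euclidean length \<open>1 / \<parallel>f'\<parallel>\<close>.  Since the second fundamental form is complex bilinear, its four
  values on the frame have the same length, and the value does not depend on the frame.
\<close>

lemma norm_second_ff_sq_holomorphic_curve:
  fixes f :: "complex \<Rightarrow> complex ^ 'n"
  assumes S: "open S" "p \<in> S"
    and f': "\<And>z i. z \<in> S \<Longrightarrow> ((\<lambda>z. f z $ i) has_field_derivative f' z $ i) (at z)"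
    and f'': "\<And>i. ((\<lambda>z. f' z $ i) has_field_derivative f'' $ i) (at p)"
    and p: "norm (f p) < 1" "f' p \<noteq> 0"
  shows "norm_second_ff_sq bergman_metric f p =
    2 * bergman_metric (f p) (bergman_normal (f p) (f' p) f'') (bergman_normal (f p) (f' p) f'')
      / (bergman_metric (f p) (f' p) (f' p))\<^sup>2"
proof -
  let ?h = "induced_metric bergman_metric f"
  define L N where "L = bergman_metric (f p) (f' p) (f' p)"
    and "N = bergman_metric (f p) (bergman_normal (f p) (f' p) f'') (bergman_normal (f p) (f' p) f'')"
  have L: "0 < L" unfolding L_def by (rule bergman_metric_pos[OF p])
  have df: "frechet_derivative f (at p) = (\<lambda>X. X *s f' p)"
    using frechet_derivative_at[OF has_derivative_holomorphic_curve[OF f'[OF S(2)]]] by simp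
  have h: "?h p X Y = L * Re (X * cnj Y)" for X Y
  proof -
    have "bergman_form (f p) (X *s f' p) (Y *s f' p) = of_real L * (X * cnj Y)"
      by (simp add: bergman_form_scale_left bergman_form_scale_right bergman_form_self_eq_metric L_def)
    then show ?thesis
      unfolding induced_metric_def df bergman_metric_eq_Re by simp
  qed
  have "orthonormal_frame2 ?h p
      (\<lambda>i. if i = 1 then complex_of_real (1 / sqrt L) else \<i> * complex_of_real (1 / sqrt L))"
    using L by (auto simp: orthonormal_frame2_def h)
  then have "orthonormal_frame2 ?h p (SOME e. orthonormal_frame2 ?h p e)"
    by (rule someI[where P = "orthonormal_frame2 ?h p"])
  then obtain e where e: "e = (SOME e. orthonormal_frame2 ?h p e)" "orthonormal_frame2 ?h p e"
    by blast
  have norm_e: "(norm (e i))\<^sup>2 = 1 / L" if "i \<in> {1,2}" for i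
  proof -
    have "?h p (e i) (e i) = 1" using e(2) that by (auto simp: orthonormal_frame2_def)
    then show ?thesis
      using L unfolding h complex_norm_square[symmetric] by (simp add: field_simps)
  qed
  have II: "second_ff bergman_metric f p X Y = (X * Y) *s bergman_normal (f p) (f' p) f''" for X Y
    by (rule second_ff_holomorphic_curve[where f = f and S = S and p = p and f' = f' and f'' = f''])
      (simp_all add: S f' f'' p)
  have "bergman_metric (f p) (second_ff bergman_metric f p (e i) (e j))
      (second_ff bergman_metric f p (e i) (e j)) = N / L\<^sup>2"
    if "i \<in> {1,2}" "j \<in> {1,2}" for i j
    unfolding II bergman_metric_scale_self norm_mult
      power_mult_distrib norm_e[OF that(1)] norm_e[OF that(2)] N_def
    by (simp add: power2_eq_square)
  then show ?thesis
    unfolding norm_second_ff_sq_def Let_def e(1)[symmetric] L_def[symmetric] N_def[symmetric]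
    by simp
qed

lemma norm_second_ff_sq_holomorphic_curve_le:
  fixes f :: "complex \<Rightarrow> complex ^ 'n"
  assumes S: "open S" "p \<in> S"
    and f': "\<And>z i. z \<in> S \<Longrightarrow> ((\<lambda>z. f z $ i) has_field_derivative f' z $ i) (at z)"
    and f'': "\<And>i. ((\<lambda>z. f' z $ i) has_field_derivative f'' $ i) (at p)"
    and p: "norm (f p) < 1" "f' p \<noteq> 0"
  shows "norm_second_ff_sq bergman_metric f p \<le>
    2 * (norm f'')\<^sup>2 / ((1 - (norm (f p))\<^sup>2)\<^sup>2 * (norm (f' p)) ^ 4)"
proof -
  have eq: "norm_second_ff_sq bergman_metric f p =
      2 * bergman_metric (f p) (bergman_normal (f p) (f' p) f'') (bergman_normal (f p) (f' p) f'')
        / (bergman_metric (f p) (f' p) (f' p))\<^sup>2"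
    by (rule norm_second_ff_sq_holomorphic_curve[where f = f and S = S and p = p and f' = f' and f'' = f''])
      (simp_all add: S f' f'' p)
  have "norm_second_ff_sq bergman_metric f p
      \<le> 2 * ((norm f'')\<^sup>2 / (1 - (norm (f p))\<^sup>2)\<^sup>2) / ((norm (f' p))\<^sup>2)\<^sup>2"
    unfolding eq
  proof (rule frac_le)
    show "2 * bergman_metric (f p) (bergman_normal (f p) (f' p) f'') (bergman_normal (f p) (f' p) f'')
        \<le> 2 * ((norm f'')\<^sup>2 / (1 - (norm (f p))\<^sup>2)\<^sup>2)"
      by (rule mult_left_mono[OF order_trans[OF bergman_metric_normal_le[OF p] bergman_metric_le[OF p(1)]]]) simp
    show "((norm (f' p))\<^sup>2)\<^sup>2 \<le> (bergman_metric (f p) (f' p) (f' p))\<^sup>2"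
      using bergman_metric_ge[OF p(1)] by (intro power_mono) auto
  qed (use p in auto)
  also have "\<dots> = 2 * (norm f'')\<^sup>2 / ((1 - (norm (f p))\<^sup>2)\<^sup>2 * (norm (f' p)) ^ 4)"
    by simp
  finally show ?thesis .
qed

section \<open>Slightly bent discs\<close>

text \<open>
  For \<open>\<bar>c\<bar> \<le> 1 / 2\<close> the factor \<open>1 / 2\<close> keeps the closure of the image away from the unit sphere, where the
  comparison of the Bergman metric with the Euclidean one breaks down.
\<close>

definition bent_disc :: "real \<Rightarrow> complex \<Rightarrow> complex ^ 2" where
  "bent_disc c z = vector [z / 2, complex_of_real c * z\<^sup>2]"

lemma norm_vector_2_sq: "(norm (vector [a, b] :: complex ^ 2))\<^sup>2 = (norm a)\<^sup>2 + (norm b)\<^sup>2"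
  by (simp add: norm_vec_def L2_set_def sum_2)

lemma bent_disc_deriv:
  "((\<lambda>z. bent_disc c z $ i) has_field_derivative
     (vector [1 / 2, complex_of_real c * (2 * z)] :: complex ^ 2) $ i) (at z)"
  using exhaust_2[of i] unfolding bent_disc_def
  by (auto intro!: derivative_eq_intros)

lemma bent_disc_deriv2:
  "((\<lambda>z. (vector [1 / 2, complex_of_real c * (2 * z)] :: complex ^ 2) $ i) has_field_derivative
     (vector [0, complex_of_real c * 2] :: complex ^ 2) $ i) (at z)"
  using exhaust_2[of i] by (auto intro!: derivative_eq_intros)

lemma bent_disc_deriv_nonzero: "(vector [1 / 2, b] :: complex ^ 2) \<noteq> 0"
  by (simp add: vec_eq_iff forall_2)

lemma norm_bent_disc:
  assumes "norm z < 1" "c\<^sup>2 \<le> 1 / 4"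
  shows "(norm (bent_disc c z))\<^sup>2 \<le> 1 / 2" "norm (bent_disc c z) < 1"
proof -
  have z: "(norm z)\<^sup>2 \<le> 1" "((norm z)\<^sup>2)\<^sup>2 \<le> 1"
    using assms(1) by (simp_all add: power_le_one)
  have "c\<^sup>2 * ((norm z)\<^sup>2)\<^sup>2 \<le> 1 / 4 * 1"
    using assms(2) z by (intro mult_mono) auto
  then show le: "(norm (bent_disc c z))\<^sup>2 \<le> 1 / 2"
    using z by (simp add: bent_disc_def norm_vector_2_sq norm_mult norm_divide norm_power
        power_mult_distrib power_divide)
  then have "(norm (bent_disc c z))\<^sup>2 < 1\<^sup>2" by simp
  then show "norm (bent_disc c z) < 1" by (rule power_less_imp_less_base) simp
qed

text \<open>
  The image is a graph over the first coordinate axis, so twice the first coordinate is a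
  continuous inverse.
\<close>

lemma holomorphic_embedding_bent_disc:
  assumes "c\<^sup>2 \<le> 1 / 4"
  shows "holomorphic_embedding complex_hyperbolic_line complex_hyperbolic (bent_disc c)"
  unfolding holomorphic_embedding_def
proof (intro conjI allI ballI)
  show "bent_disc c ` complex_hyperbolic_line \<subseteq> complex_hyperbolic"
    using norm_bent_disc(2)[OF _ assms]
    by (auto simp: complex_hyperbolic_line_def complex_hyperbolic_def)
  show "(\<lambda>z. bent_disc c z $ i) holomorphic_on complex_hyperbolic_line" for i
    unfolding holomorphic_on_def field_differentiable_def
    using bent_disc_deriv by (blast intro: has_field_derivative_at_within)
  show "inj (frechet_derivative (bent_disc c) (at z))" for z
    unfolding frechet_derivative_at[OF has_derivative_holomorphic_curve[OF bent_disc_deriv], symmetric]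
    by (auto intro!: injI simp: vec_eq_iff forall_2)
  have "continuous_on complex_hyperbolic_line (bent_disc c)"
    by (meson continuous_at_imp_continuous_on has_derivative_continuous
        has_derivative_holomorphic_curve bent_disc_deriv)
  then have "homeomorphism complex_hyperbolic_line (bent_disc c ` complex_hyperbolic_line)
      (bent_disc c) (\<lambda>w. 2 * w $ 1)"
    unfolding homeomorphism_def
    by (auto intro!: continuous_intros simp: bent_disc_def image_image power_divide)
  then show "\<exists>h. homeomorphism complex_hyperbolic_line (bent_disc c ` complex_hyperbolic_line)
      (bent_disc c) h" by blast
qed

lemma norm_second_ff_sq_bent_disc_le:
  assumes "norm z < 1" "c\<^sup>2 \<le> 1 / 4"
  shows "norm_second_ff_sq bergman_metric (bent_disc c) z \<le> 512 * c\<^sup>2"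
proof -
  let ?t = "vector [1 / 2, complex_of_real c * (2 * z)] :: complex ^ 2"
  have "norm_second_ff_sq bergman_metric (bent_disc c) z \<le>
      2 * (norm (vector [0, complex_of_real c * 2] :: complex ^ 2))\<^sup>2
        / ((1 - (norm (bent_disc c z))\<^sup>2)\<^sup>2 * (norm ?t) ^ 4)"
    by (rule norm_second_ff_sq_holomorphic_curve_le[OF open_UNIV UNIV_I bent_disc_deriv
          bent_disc_deriv2 norm_bent_disc(2)[OF assms] bent_disc_deriv_nonzero])
  also have "\<dots> \<le> 2 * (4 * c\<^sup>2) / ((1 / 2)\<^sup>2 * (1 / 4)\<^sup>2)"
  proof (rule frac_le)
    have four: "x ^ 4 = (x\<^sup>2)\<^sup>2" for x :: real by simp
    have "1 / 4 \<le> (norm ?t)\<^sup>2"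
      by (simp add: norm_vector_2_sq power_divide)
    then have "(1 / 4)\<^sup>2 \<le> ((norm ?t)\<^sup>2)\<^sup>2" by (intro power_mono) auto
    moreover have "(1 / 2)\<^sup>2 \<le> (1 - (norm (bent_disc c z))\<^sup>2)\<^sup>2"
      using norm_bent_disc(1)[OF assms] by (intro power_mono) auto
    ultimately show "(1 / 2)\<^sup>2 * (1 / 4)\<^sup>2 \<le> (1 - (norm (bent_disc c z))\<^sup>2)\<^sup>2 * (norm ?t) ^ 4"
      unfolding four by (intro mult_mono) auto
  qed (auto simp: norm_vector_2_sq norm_mult power_mult_distrib)
  finally show ?thesis by (simp add: power2_eq_square)
qed

text \<open>
  At the centre of the ball the Bergman metric is the Euclidean one, for which \<open>f' = (1 / 2, 0)\<close> and
  \<open>f'' = (0, 2 c)\<close> are orthogonal.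
\<close>

lemma bent_disc_not_totally_geodesic:
  assumes "c \<noteq> 0"
  shows "\<not> totally_geodesic_on bergman_metric complex_hyperbolic_line (bent_disc c)"
proof
  assume "totally_geodesic_on bergman_metric complex_hyperbolic_line (bent_disc c)"
  then have "second_ff bergman_metric (bent_disc c) 0 1 1 = 0"
    by (auto simp: totally_geodesic_on_def complex_hyperbolic_line_def)
  moreover have f0: "bent_disc c 0 = 0"
    by (simp add: bent_disc_def vec_eq_iff forall_2)
  ultimately have "bergman_normal 0 (vector [1 / 2, 0]) (vector [0, complex_of_real c * 2] :: complex ^ 2) = 0"
    using second_ff_holomorphic_curve[OF open_UNIV UNIV_I bent_disc_deriv bent_disc_deriv2, of c 0 1 1]
      bent_disc_deriv_nonzero by simp
  then have "(vector [0, complex_of_real c * 2] :: complex ^ 2) $ 2 = 0"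
    by (simp add: bergman_normal_def bergman_form_def hermitian_def sum_2 vec_eq_iff forall_2)
  then show False using assms by simp
qed

theorem corollary1p2:
  fixes \<eta> :: real
  assumes "\<eta> > 0"
  shows "\<exists>f :: complex \<Rightarrow> complex ^ 2.
    holomorphic_embedding complex_hyperbolic_line complex_hyperbolic f
    \<and> bdd_above (norm_second_ff_sq bergman_metric f ` complex_hyperbolic_line)
    \<and> (SUP z\<in>complex_hyperbolic_line. norm_second_ff_sq bergman_metric f z) < \<eta>
    \<and> \<not> totally_geodesic_on bergman_metric complex_hyperbolic_line f"
proof -
  \<comment> \<open>The second entry of the minimum makes \<open>512 c\<^sup>2 \<le> \<eta> / 2\<close>; the slack keeps the supremum strictly below \<open>\<eta>\<close>.\<close>
  define c where "c = sqrt (min (1 / 4) (\<eta> / 1024))"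
  have c: "c \<noteq> 0" "c\<^sup>2 \<le> 1 / 4" "512 * c\<^sup>2 < \<eta>"
    using assms by (auto simp: c_def min_def)
  have le: "norm_second_ff_sq bergman_metric (bent_disc c) z \<le> 512 * c\<^sup>2"
    if "z \<in> complex_hyperbolic_line" for z
    using norm_second_ff_sq_bent_disc_le[OF _ c(2)] that by (simp add: complex_hyperbolic_line_def)
  have "(SUP z\<in>complex_hyperbolic_line. norm_second_ff_sq bergman_metric (bent_disc c) z) \<le> 512 * c\<^sup>2"
    using le by (intro cSUP_least) (auto simp: complex_hyperbolic_line_def)
  then have "(SUP z\<in>complex_hyperbolic_line. norm_second_ff_sq bergman_metric (bent_disc c) z) < \<eta>"
    using c(3) by linarith
  moreover have "bdd_above (norm_second_ff_sq bergman_metric (bent_disc c) ` complex_hyperbolic_line)"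
    using le by (auto intro!: bdd_aboveI)
  ultimately show ?thesis
    using holomorphic_embedding_bent_disc[OF c(2)] bent_disc_not_totally_geodesic[OF c(1)] by blast
qed

end
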